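(* Let $V$ be a vector space and $g:V\to V$ a linear endomorphism. Let $W$ be a subspace of $V$ such that $V=\sum_{n=0}^\infty g^n(W)$. Then $T(V,g)$ is generated, as a pre-Lie algebra, by $T(W)$. Moreover, if $(w_d)_{d\in\mathcal{D}}$ is a totally ordered basis of $W$, then $T(V,g)$ is generated, as a Com-Pre-Lie algebra, by $\emptyset$ and the set of Lyndon words in the letters $w_d$, $d\in\mathcal{D}$.
   Context: $\mathbb{K}$ is a field of characteristic zero. For a vector space $V$, $T(V)=\bigoplus_{n\ge 0}V^{\otimes n}$ is spanned by words with letters in $V$; $\emptyset$ is the empty word; juxtaposition is concatenation. The shuffle product $\sqcup\!\sqcup$ is the bilinear product with unit $\emptyset$ and $xu\sqcup\!\sqcup yv=x(u\sqcup\!\sqcup yv)+y(xu\sqcup\!\sqcup v)$ for $x,y\in V$, $u,v\in T(V)$. For a linear endomorphism $g$ of $V$, the bilinear product $\bullet$ on $T(V)$ is defined by $\emptyset\bullet w'=0$ and $(xw)\bullet w'=x(w\bullet w')+g(x)(w\sqcup\!\sqcup w')$ for $x\in V$, $w,w'\in T(V)$. $T(V,g)$ denotes $T(V)$ with these two products. It is a Com-Pre-Lie algebra: $\sqcup\!\sqcup$ is commutative and associative, $\bullet$ is right pre-Lie, i.e. $(a\bullet b)\bullet c-a\bullet(b\bullet c)=(a\bullet c)\bullet b-a\bullet(c\bullet b)$, and $(a\sqcup\!\sqcup b)\bullet c=(a\bullet c)\sqcup\!\sqcup b+a\sqcup\!\sqcup(b\bullet c)$. "Generated as a pre-Lie algebra"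 means using $\bullet$ (and linear combinations); "generated as a Com-Pre-Lie algebra" means using $\sqcup\!\sqcup$ and $\bullet$. *)

theory Defs
  imports Complex_Main "HOL-Library.Poly_Mapping"
begin

section \<open>Free vector spaces on words\<close>

definition fscale :: "'k::field \<Rightarrow> ('x \<Rightarrow>\<^sub>0 'k) \<Rightarrow> ('x \<Rightarrow>\<^sub>0 'k)"
  where "fscale c p = Poly_Mapping.map ((*) c) p"

lemma lookup_fscale [simp]: "poly_mapping.lookup (fscale c p) x = c * poly_mapping.lookup p x"
  unfolding fscale_def by transfer (simp add: when_def)

interpretation free: vector_space "fscale :: 'k::field \<Rightarrow> ('x \<Rightarrow>\<^sub>0 'k) \<Rightarrow> ('x \<Rightarrow>\<^sub>0 'k)"
  by unfold_locales (auto intro!: poly_mapping_eqI simp: lookup_add algebra_simps)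

abbreviation word :: "'x \<Rightarrow> ('x \<Rightarrow>\<^sub>0 'k::field)"
  where "word u \<equiv> Poly_Mapping.single u 1"

definition lin_ext :: "('x \<Rightarrow> ('y \<Rightarrow>\<^sub>0 'k)) \<Rightarrow> ('x \<Rightarrow>\<^sub>0 'k::field) \<Rightarrow> ('y \<Rightarrow>\<^sub>0 'k)"
  where "lin_ext f p = (\<Sum>x\<in>Poly_Mapping.keys p. fscale (poly_mapping.lookup p x) (f x))"

definition bilin_ext ::
    "('x \<Rightarrow> 'y \<Rightarrow> ('z \<Rightarrow>\<^sub>0 'k)) \<Rightarrow> ('x \<Rightarrow>\<^sub>0 'k::field) \<Rightarrow> ('y \<Rightarrow>\<^sub>0 'k) \<Rightarrow> ('z \<Rightarrow>\<^sub>0 'k)"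
  where "bilin_ext f p q = lin_ext (\<lambda>u. lin_ext (f u) q) p"

definition prepend :: "'v \<Rightarrow> ('v list \<Rightarrow>\<^sub>0 'k::field) \<Rightarrow> ('v list \<Rightarrow>\<^sub>0 'k)"
  where "prepend x = lin_ext (\<lambda>u. word (x # u))"

fun shuffle_words :: "'v list \<Rightarrow> 'v list \<Rightarrow> ('v list \<Rightarrow>\<^sub>0 'k::field)" where
  "shuffle_words [] v = word v"
| "shuffle_words (x # u) [] = word (x # u)"
| "shuffle_words (x # u) (y # v) =
     prepend x (shuffle_words u (y # v)) + prepend y (shuffle_words (x # u) v)"

fun bullet_words :: "('v \<Rightarrow> 'v) \<Rightarrow> 'v list \<Rightarrow> 'v list \<Rightarrow> ('v list \<Rightarrow>\<^sub>0 'k::field)" where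
  "bullet_words g [] v = 0"
| "bullet_words g (x # u) v = prepend x (bullet_words g u v) + prepend (g x) (shuffle_words u v)"

section \<open>The tensor algebra\<close>

text \<open>
  \<open>T(V)\<close> is the free vector space on all finite words in \<open>V\<close>, modulo the relations making the
  words multilinear in their letters. Its elements are the cosets of the relation subspace.
\<close>

definition tensor_rel :: "('k::field \<Rightarrow> 'v::ab_group_add \<Rightarrow> 'v) \<Rightarrow> ('v list \<Rightarrow>\<^sub>0 'k) set"
  where "tensor_rel scale = module.span fscale
    ({word (u @ (x + y) # v) - word (u @ x # v) - word (u @ y # v) | u x y v. True} \<union>
     {word (u @ scale c x # v) - fscale c (word (u @ x # v)) | u c x v. True})"

definition tclass ::
    "('k::field \<Rightarrow> 'v::ab_group_add \<Rightarrow> 'v) \<Rightarrow> ('v list \<Rightarrow>\<^sub>0 'k) \<Rightarrow> ('v list \<Rightarrow>\<^sub>0 'k) set"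
  where "tclass scale p = {q. q - p \<in> tensor_rel scale}"

definition tensors :: "('k::field \<Rightarrow> 'v::ab_group_add \<Rightarrow> 'v) \<Rightarrow> ('v list \<Rightarrow>\<^sub>0 'k) set set"
  where "tensors scale = range (tclass scale)"

definition tword :: "('k::field \<Rightarrow> 'v::ab_group_add \<Rightarrow> 'v) \<Rightarrow> 'v list \<Rightarrow> ('v list \<Rightarrow>\<^sub>0 'k) set"
  where "tword scale u = tclass scale (word u)"

text \<open>
  Operations on cosets are given by representatives; the union collapses to a single coset because
  the operations respect the relations (see the lemmas \<open>tadd_tclass\<close> to \<open>tbullet_tclass\<close>).
\<close>

definition tadd where
  "tadd scale A B = (\<Union>p\<in>A. \<Union>q\<in>B. tclass scale (p + q))"

definition tscale where
  "tscale scale c A = (\<Union>p\<in>A. tclass scale (fscale c p))"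

definition tshuffle where
  "tshuffle scale A B = (\<Union>p\<in>A. \<Union>q\<in>B. tclass scale (bilin_ext shuffle_words p q))"

definition tbullet where
  "tbullet scale g A B = (\<Union>p\<in>A. \<Union>q\<in>B. tclass scale (bilin_ext (bullet_words g) p q))"

text \<open>\<open>T(W)\<close>, as a subspace of \<open>T(V)\<close>: linear combinations of words with letters in \<open>W\<close>.\<close>

definition tensors_on ::
    "('k::field \<Rightarrow> 'v::ab_group_add \<Rightarrow> 'v) \<Rightarrow> 'v set \<Rightarrow> ('v list \<Rightarrow>\<^sub>0 'k) set set"
  where "tensors_on scale W = tclass scale ` module.span fscale (word ` lists W)"

section \<open>Subalgebras\<close>

definition tsubspace ::
    "('k::field \<Rightarrow> 'v::ab_group_add \<Rightarrow> 'v) \<Rightarrow> ('v list \<Rightarrow>\<^sub>0 'k) set set \<Rightarrow> bool"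
  where "tsubspace scale U \<longleftrightarrow> U \<subseteq> tensors scale \<and> tclass scale 0 \<in> U \<and>
    (\<forall>A\<in>U. \<forall>B\<in>U. tadd scale A B \<in> U) \<and> (\<forall>c. \<forall>A\<in>U. tscale scale c A \<in> U)"

definition pre_lie_subalgebra ::
    "('k::field \<Rightarrow> 'v::ab_group_add \<Rightarrow> 'v) \<Rightarrow> ('v \<Rightarrow> 'v) \<Rightarrow> ('v list \<Rightarrow>\<^sub>0 'k) set set \<Rightarrow> bool"
  where "pre_lie_subalgebra scale g U \<longleftrightarrow>
    tsubspace scale U \<and> (\<forall>A\<in>U. \<forall>B\<in>U. tbullet scale g A B \<in> U)"

definition com_pre_lie_subalgebra ::
    "('k::field \<Rightarrow> 'v::ab_group_add \<Rightarrow> 'v) \<Rightarrow> ('v \<Rightarrow> 'v) \<Rightarrow> ('v list \<Rightarrow>\<^sub>0 'k) set set \<Rightarrow> bool"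
  where "com_pre_lie_subalgebra scale g U \<longleftrightarrow>
    pre_lie_subalgebra scale g U \<and> (\<forall>A\<in>U. \<forall>B\<in>U. tshuffle scale A B \<in> U)"

section \<open>Lyndon words\<close>

text \<open>A nonempty word strictly smaller than each of its nonempty proper suffixes, for the
  lexicographic order in which a proper prefix precedes the longer word.\<close>

definition lyndon :: "'d::linorder list \<Rightarrow> bool"
  where "lyndon u \<longleftrightarrow> u \<noteq> [] \<and>
    (\<forall>v w. u = v @ w \<longrightarrow> v \<noteq> [] \<longrightarrow> w \<noteq> [] \<longrightarrow> (u, w) \<in> lexord {(a, b). a < b})"

section \<open>Well-definedness of the operations\<close>

lemma lin_ext_superset:
  assumes "finite A" "Poly_Mapping.keys p \<subseteq> A"
  shows "lin_ext f p = (\<Sum>x\<in>A. fscale (poly_mapping.lookup p x) (f x))"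
  unfolding lin_ext_def
  by (rule sum.mono_neutral_left) (use assms in \<open>auto simp: in_keys_iff\<close>)

lemma lin_ext_add: "lin_ext f (p + q) = lin_ext f p + lin_ext f q"
proof -
  let ?A = "Poly_Mapping.keys p \<union> Poly_Mapping.keys q"
  have "lin_ext f (p + q) = (\<Sum>x\<in>?A. fscale (poly_mapping.lookup (p + q) x) (f x))"
    by (rule lin_ext_superset) (use Poly_Mapping.keys_add[of p q] in auto)
  also have "\<dots> = (\<Sum>x\<in>?A. fscale (poly_mapping.lookup p x) (f x)) + (\<Sum>x\<in>?A. fscale (poly_mapping.lookup q x) (f x))"
    by (simp add: lookup_add free.scale_left_distrib sum.distrib)
  also have "\<dots> = lin_ext f p + lin_ext f q"
    by (simp add: lin_ext_superset[of ?A])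
  finally show ?thesis .
qed

lemma lin_ext_scale: "lin_ext f (fscale c p) = fscale c (lin_ext f p)"
proof -
  have "lin_ext f (fscale c p) = (\<Sum>x\<in>Poly_Mapping.keys p. fscale (poly_mapping.lookup (fscale c p) x) (f x))"
    by (rule lin_ext_superset) (auto simp: in_keys_iff)
  thus ?thesis by (simp add: lin_ext_def free.scale_sum_right)
qed

lemma linear_lin_ext: "Vector_Spaces.linear fscale fscale (lin_ext f)"
  by unfold_locales (simp_all add: lin_ext_add lin_ext_scale)

lemma lin_ext_zero [simp]: "lin_ext f 0 = 0"
  by (simp add: lin_ext_def)

lemma lin_ext_minus: "lin_ext f (- p) = - lin_ext f p"
  using lin_ext_add[of f p "- p"] by (simp add: eq_neg_iff_add_eq_0 add.commute)

lemma lin_ext_diff: "lin_ext f (p - q) = lin_ext f p - lin_ext f q"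
  using lin_ext_add[of f p "- q"] by (simp add: lin_ext_minus)

lemma lin_ext_word [simp]: "lin_ext f (word u) = f u"
  by (simp add: lin_ext_def)

lemma lin_ext_mem:
  assumes "module.subspace fscale S" "\<And>x. f x \<in> S"
  shows "lin_ext f p \<in> S"
  unfolding lin_ext_def using assms
  by (intro free.subspace_sum) (auto intro: free.subspace_scale)

lemma lin_ext_fun_add: "lin_ext (\<lambda>x. f x + h x) p = lin_ext f p + lin_ext h p"
  by (simp add: lin_ext_def free.scale_right_distrib sum.distrib)

lemma lin_ext_fun_diff: "lin_ext (\<lambda>x. f x - h x) p = lin_ext f p - lin_ext h p"
  by (simp add: lin_ext_def free.scale_right_diff_distrib sum_subtractf)

lemma lin_ext_fun_scale: "lin_ext (\<lambda>x. fscale c (f x)) p = fscale c (lin_ext f p)"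
  by (simp add: lin_ext_def free.scale_sum_right mult.commute)

lemma bilin_ext_diff_left: "bilin_ext f (p - p') q = bilin_ext f p q - bilin_ext f p' q"
  by (simp add: bilin_ext_def lin_ext_diff)

lemma bilin_ext_diff_right: "bilin_ext f p (q - q') = bilin_ext f p q - bilin_ext f p q'"
  by (simp add: bilin_ext_def lin_ext_diff lin_ext_fun_diff)

lemma bilin_ext_flip: "bilin_ext f p q = bilin_ext (\<lambda>v u. f u v) q p"
  unfolding bilin_ext_def lin_ext_def
  by (simp add: free.scale_sum_right mult.commute) (rule sum.swap)

lemma shuffle_words_Nil_right [simp]: "shuffle_words u [] = word u"
  by (cases u) auto

lemma shuffle_words_commute: "shuffle_words u v = shuffle_words v u"
  by (induction u v rule: shuffle_words.induct) (simp_all add: add.commute)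

lemma subspace_tensor_rel: "module.subspace fscale (tensor_rel scale)"
  by (simp add: tensor_rel_def)

lemmas tensor_rel_closed =
  free.subspace_0[OF subspace_tensor_rel] free.subspace_add[OF subspace_tensor_rel]
  free.subspace_diff[OF subspace_tensor_rel] free.subspace_scale[OF subspace_tensor_rel]

text \<open>A map from words into the free space is \<^emph>\<open>multilinear modulo the relations\<close> if it sends the
  generators of the relation subspace into it; its linear extension then preserves the subspace.\<close>

definition respects_rel ::
    "('k::field \<Rightarrow> 'v::ab_group_add \<Rightarrow> 'v) \<Rightarrow> ('v list \<Rightarrow> ('v list \<Rightarrow>\<^sub>0 'k)) \<Rightarrow> bool"
  where "respects_rel scale f \<longleftrightarrow>
    (\<forall>u x y v. f (u @ (x + y) # v) - f (u @ x # v) - f (u @ y # v) \<in> tensor_rel scale) \<and>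
    (\<forall>u c x v. f (u @ scale c x # v) - fscale c (f (u @ x # v)) \<in> tensor_rel scale)"

lemma respects_rel_lin_ext:
  assumes "respects_rel scale f" "p \<in> tensor_rel scale"
  shows "lin_ext f p \<in> tensor_rel scale"
proof -
  have "module.subspace fscale {p. lin_ext f p \<in> tensor_rel scale}"
    by (rule free.subspaceI) (auto simp: lin_ext_add lin_ext_scale tensor_rel_closed)
  moreover have "p \<in> module.span fscale
    ({word (u @ (x + y) # v) - word (u @ x # v) - word (u @ y # v) | u x y v. True} \<union>
     {word (u @ scale c x # v) - fscale c (word (u @ x # v)) | u c x v. True})"
    using assms(2) by (simp add: tensor_rel_def)
  ultimately show ?thesis
    using assms(1)
    by (elim free.span_induct) (auto simp: respects_rel_def lin_ext_diff lin_ext_scale)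
qed

lemma rel_add: "word (u @ (x + y) # v) - word (u @ x # v) - word (u @ y # v) \<in> tensor_rel scale"
  unfolding tensor_rel_def by (rule free.span_base) blast

lemma rel_scale: "word (u @ scale c x # v) - fscale c (word (u @ x # v)) \<in> tensor_rel scale"
  unfolding tensor_rel_def by (rule free.span_base) blast

lemma respects_word: "respects_rel scale word"
  by (simp add: respects_rel_def rel_add rel_scale)

lemma respects_Cons: "respects_rel scale (\<lambda>u. word (x # u))"
  unfolding respects_rel_def append_Cons[symmetric] by (blast intro: rel_add rel_scale)

lemma prepend_rel: "p \<in> tensor_rel scale \<Longrightarrow> prepend x p \<in> tensor_rel scale"
  unfolding prepend_def by (rule respects_rel_lin_ext[OF respects_Cons])

lemma prepend_letter_add: "prepend (x + y) p - prepend x p - prepend y p \<in> tensor_rel scale"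
  unfolding prepend_def lin_ext_fun_diff[symmetric]
  by (rule lin_ext_mem[OF subspace_tensor_rel]) (use rel_add[of "[]"] in simp)

lemma prepend_letter_scale: "prepend (scale c x) p - fscale c (prepend x p) \<in> tensor_rel scale"
  unfolding prepend_def lin_ext_fun_diff[symmetric] lin_ext_fun_scale[symmetric]
  by (rule lin_ext_mem[OF subspace_tensor_rel]) (use rel_scale[of "[]"] in simp)

lemma prepend_linear [simp]:
  "prepend x (p + q) = prepend x p + prepend x q"
  "prepend x (p - q) = prepend x p - prepend x q"
  "prepend x (fscale c p) = fscale c (prepend x p)"
  "prepend x 0 = 0"
  by (simp_all add: prepend_def lin_ext_add lin_ext_diff lin_ext_scale)

lemma respects_add:
  assumes "respects_rel scale f" "respects_rel scale h"
  shows "respects_rel scale (\<lambda>u. f u + h u)"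
proof -
  have "f (u @ (x + y) # v) + h (u @ (x + y) # v) - (f (u @ x # v) + h (u @ x # v))
      - (f (u @ y # v) + h (u @ y # v)) \<in> tensor_rel scale" for u x y v
  proof -
    have "f (u @ (x + y) # v) - f (u @ x # v) - f (u @ y # v) \<in> tensor_rel scale"
      "h (u @ (x + y) # v) - h (u @ x # v) - h (u @ y # v) \<in> tensor_rel scale"
      using assms by (simp_all add: respects_rel_def)
    from tensor_rel_closed(2)[OF this] show ?thesis by (simp add: algebra_simps)
  qed
  moreover have "f (u @ scale c x # v) + h (u @ scale c x # v)
      - fscale c (f (u @ x # v) + h (u @ x # v)) \<in> tensor_rel scale" for u c x v
  proof -
    have "f (u @ scale c x # v) - fscale c (f (u @ x # v)) \<in> tensor_rel scale"
      "h (u @ scale c x # v) - fscale c (h (u @ x # v)) \<in> tensor_rel scale"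
      using assms by (simp_all add: respects_rel_def)
    from tensor_rel_closed(2)[OF this] show ?thesis
      by (simp add: free.scale_right_distrib algebra_simps)
  qed
  ultimately show ?thesis by (simp add: respects_rel_def)
qed

lemma respects_shuffle: "respects_rel scale (\<lambda>u. shuffle_words u v)"
proof -
  have A: "shuffle_words (u @ (x + y) # u') v - shuffle_words (u @ x # u') v
      - shuffle_words (u @ y # u') v \<in> tensor_rel scale" for u x y u'
  proof (induction "length u + length v" arbitrary: u v rule: less_induct)
    case (less u v)
    show ?case
    proof (cases v)
      case Nil
      then show ?thesis by (simp add: rel_add)
    next
      case v: (Cons b v')
      have 1: "prepend b (shuffle_words (u @ (x + y) # u') v') - prepend b (shuffle_words (u @ x # u') v')
          - prepend b (shuffle_words (u @ y # u') v') \<in> tensor_rel scale"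
        using prepend_rel[OF less(1)[of u v'], of b] v by simp
      show ?thesis
      proof (cases u)
        case Nil
        show ?thesis
          using tensor_rel_closed(2)[OF 1 prepend_letter_add[of x y "shuffle_words u' v"]] v Nil
          by (simp add: algebra_simps)
      next
        case u: (Cons a u1)
        show ?thesis
          using tensor_rel_closed(2)[OF 1 prepend_rel[OF less(1)[of u1 v], of a]] v u
          by (simp add: algebra_simps)
      qed
    qed
  qed
  have B: "shuffle_words (u @ scale c x # u') v - fscale c (shuffle_words (u @ x # u') v)
      \<in> tensor_rel scale" for u c x u'
  proof (induction "length u + length v" arbitrary: u v rule: less_induct)
    case (less u v)
    show ?case
    proof (cases v)
      case Nil
      then show ?thesis by (simp add: rel_scale)
    next
      case v: (Cons b v')
      have 1: "prepend b (shuffle_words (u @ scale c x # u') v')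
          - fscale c (prepend b (shuffle_words (u @ x # u') v')) \<in> tensor_rel scale"
        using prepend_rel[OF less(1)[of u v'], of b] v by simp
      show ?thesis
      proof (cases u)
        case Nil
        show ?thesis
          using tensor_rel_closed(2)[OF 1 prepend_letter_scale[of scale c x "shuffle_words u' v"]] v Nil
          by (simp add: free.scale_right_distrib algebra_simps)
      next
        case u: (Cons a u1)
        show ?thesis
          using tensor_rel_closed(2)[OF 1 prepend_rel[OF less(1)[of u1 v], of a]] v u
          by (simp add: free.scale_right_distrib algebra_simps)
      qed
    qed
  qed
  show ?thesis using A B by (simp add: respects_rel_def)
qed

lemma respects_bullet_left:
  assumes g: "Vector_Spaces.linear scale scale g"
  shows "respects_rel scale (\<lambda>u. bullet_words g u v)"
proof -
  have gadd: "g (x + y) = g x + g y" and gscale: "g (scale c x) = scale c (g x)" for x y c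
    using g by (simp_all add: Vector_Spaces.linear_iff)
  have sh: "shuffle_words (u @ (x + y) # u') v - shuffle_words (u @ x # u') v
      - shuffle_words (u @ y # u') v \<in> tensor_rel scale"
    "shuffle_words (u @ scale c x # u') v - fscale c (shuffle_words (u @ x # u') v)
      \<in> tensor_rel scale" for u x y c u'
    using respects_shuffle[of scale v] by (auto simp: respects_rel_def)
  have A: "bullet_words g (u @ (x + y) # u') v - bullet_words g (u @ x # u') v
      - bullet_words g (u @ y # u') v \<in> tensor_rel scale" for u x y u'
  proof (induction u)
    case Nil
    show ?case
      using tensor_rel_closed(2)[OF prepend_letter_add[of x y "bullet_words g u' v" scale]
          prepend_letter_add[of "g x" "g y" "shuffle_words u' v"]]
      by (simp add: gadd algebra_simps)
  next
    case (Cons a u)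
    show ?case
      using tensor_rel_closed(2)[OF prepend_rel[OF Cons, of a] prepend_rel[OF sh(1)[of u x y u'], of "g a"]]
      by (simp add: algebra_simps)
  qed
  have B: "bullet_words g (u @ scale c x # u') v - fscale c (bullet_words g (u @ x # u') v)
      \<in> tensor_rel scale" for u c x u'
  proof (induction u)
    case Nil
    show ?case
      using tensor_rel_closed(2)[OF prepend_letter_scale[of scale c x "bullet_words g u' v"]
          prepend_letter_scale[of scale c "g x" "shuffle_words u' v"]]
      by (simp add: gscale free.scale_right_distrib algebra_simps)
  next
    case (Cons a u)
    show ?case
      using tensor_rel_closed(2)[OF prepend_rel[OF Cons, of a] prepend_rel[OF sh(2)[of u c x u'], of "g a"]]
      by (simp add: free.scale_right_distrib algebra_simps)
  qed
  show ?thesis using A B by (simp add: respects_rel_def)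
qed

lemma respects_prepend:
  assumes "respects_rel scale f"
  shows "respects_rel scale (\<lambda>u. prepend x (f u))"
  unfolding respects_rel_def
  using assms by (auto simp: respects_rel_def prepend_linear(2,3)[symmetric]
      simp del: prepend_linear intro!: prepend_rel)

lemma respects_bullet_right: "respects_rel scale (\<lambda>v. bullet_words g u v)"
proof (induction u)
  case Nil
  show ?case by (simp add: respects_rel_def tensor_rel_closed)
next
  case (Cons a u)
  have "respects_rel scale (\<lambda>v. shuffle_words u v)"
    using respects_shuffle[of scale u] by (simp add: shuffle_words_commute[of u])
  then show ?case
    unfolding bullet_words.simps
    by (rule respects_add[OF respects_prepend[OF Cons] respects_prepend])
qed

lemma bilin_ext_cong_rel:
  assumes "\<And>v. respects_rel scale (\<lambda>u. f u v)" "\<And>u. respects_rel scale (f u)"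
    and "p' - p \<in> tensor_rel scale" "q' - q \<in> tensor_rel scale"
  shows "bilin_ext f p' q' - bilin_ext f p q \<in> tensor_rel scale"
proof -
  have "bilin_ext f p' (q' - q) \<in> tensor_rel scale"
    unfolding bilin_ext_def
    by (rule lin_ext_mem[OF subspace_tensor_rel], rule respects_rel_lin_ext) (fact assms)+
  moreover have "bilin_ext f (p' - p) q \<in> tensor_rel scale"
  proof -
    have "lin_ext (\<lambda>u. f u v) (p' - p) \<in> tensor_rel scale" for v
      by (rule respects_rel_lin_ext[OF assms(1,3)])
    then show ?thesis
      by (subst bilin_ext_flip) (simp add: bilin_ext_def lin_ext_mem[OF subspace_tensor_rel])
  qed
  ultimately have "bilin_ext f p' (q' - q) + bilin_ext f (p' - p) q \<in> tensor_rel scale"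
    by (rule tensor_rel_closed)
  then show ?thesis by (simp add: bilin_ext_diff_left bilin_ext_diff_right)
qed

lemma tclass_self: "p \<in> tclass scale p"
  by (simp add: tclass_def tensor_rel_closed)

lemma tclass_eq_iff: "tclass scale p = tclass scale q \<longleftrightarrow> p - q \<in> tensor_rel scale"
proof
  assume "tclass scale p = tclass scale q"
  then have "p \<in> tclass scale q" using tclass_self[of p scale] by simp
  then show "p - q \<in> tensor_rel scale" by (simp add: tclass_def)
next
  assume *: "p - q \<in> tensor_rel scale"
  have "r - p \<in> tensor_rel scale \<longleftrightarrow> r - q \<in> tensor_rel scale" for r
  proof
    assume "r - p \<in> tensor_rel scale"
    from tensor_rel_closed(2)[OF this *] show "r - q \<in> tensor_rel scale" by simp
  next
    assume "r - q \<in> tensor_rel scale"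
    from tensor_rel_closed(3)[OF this *] show "r - p \<in> tensor_rel scale" by simp
  qed
  then show "tclass scale p = tclass scale q" by (simp add: tclass_def)
qed

lemma tclass_lift2:
  assumes "\<And>p' q'. p' - p \<in> tensor_rel scale \<Longrightarrow> q' - q \<in> tensor_rel scale \<Longrightarrow>
    f p' q' - f p q \<in> tensor_rel scale"
  shows "(\<Union>p'\<in>tclass scale p. \<Union>q'\<in>tclass scale q. tclass scale (f p' q')) = tclass scale (f p q)"
proof -
  have "tclass scale (f p' q') = tclass scale (f p q)"
    if "p' \<in> tclass scale p" "q' \<in> tclass scale q" for p' q'
    using that assms unfolding tclass_eq_iff by (simp add: tclass_def)
  then show ?thesis using tclass_self[of p scale] tclass_self[of q scale] by blast
qed

lemma tadd_tclass: "tadd scale (tclass scale p) (tclass scale q) = tclass scale (p + q)"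
  unfolding tadd_def
proof (rule tclass_lift2)
  fix p' q' assume "p' - p \<in> tensor_rel scale" "q' - q \<in> tensor_rel scale"
  from tensor_rel_closed(2)[OF this] show "p' + q' - (p + q) \<in> tensor_rel scale"
    by (simp add: algebra_simps)
qed

lemma tscale_tclass: "tscale scale c (tclass scale p) = tclass scale (fscale c p)"
proof -
  have "tclass scale (fscale c p') = tclass scale (fscale c p)" if "p' \<in> tclass scale p" for p'
    using that tensor_rel_closed(4)[of "p' - p" scale c]
    unfolding tclass_eq_iff by (simp add: tclass_def free.scale_right_diff_distrib)
  then show ?thesis using tclass_self[of p scale] unfolding tscale_def by blast
qed

lemma tshuffle_tclass:
  "tshuffle scale (tclass scale p) (tclass scale q) = tclass scale (bilin_ext shuffle_words p q)"
proof -
  have "respects_rel scale (\<lambda>v. shuffle_words u v)" for u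
    using respects_shuffle[of scale u] by (simp add: shuffle_words_commute[of u])
  then show ?thesis
    unfolding tshuffle_def by (intro tclass_lift2 bilin_ext_cong_rel respects_shuffle)
qed

lemma tbullet_tclass:
  assumes "Vector_Spaces.linear scale scale g"
  shows "tbullet scale g (tclass scale p) (tclass scale q)
    = tclass scale (bilin_ext (bullet_words g) p q)"
  unfolding tbullet_def
  by (intro tclass_lift2 bilin_ext_cong_rel respects_bullet_left respects_bullet_right assms)

lemma com_pre_lie_subalgebra_tensors:
  assumes "Vector_Spaces.linear scale scale g"
  shows "com_pre_lie_subalgebra scale g (tensors scale)"
  by (auto simp: com_pre_lie_subalgebra_def pre_lie_subalgebra_def tsubspace_def tensors_def
      tadd_tclass tscale_tclass tshuffle_tclass tbullet_tclass[OF assms])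

end

theory Submission
  imports Defs "HOL-Library.List_Lexorder" "HOL-Library.Sublist"
begin

text \<open>
  A subalgebra \<open>U\<close> of \<open>T(V,g)\<close> is studied through its preimage \<open>S\<close> in the free vector space on
  words: a subspace that contains the relations and is closed under the products. To prove that
  \<open>U\<close> is everything, it suffices that \<open>S\<close> contains all words.

  \<^emph>\<open>Pre-Lie generation.\<close> In \<open>(x\<^sub>1 \<dots> x\<^sub>k y) \<bullet> s\<close> the map \<open>g\<close> hits one letter of the left factor. If it
  hits \<open>y\<close>, the result is \<open>x\<^sub>1 \<dots> x\<^sub>k g(y) s\<close>; otherwise a letter \<open>g(x\<^sub>i)\<close> appears after only
  \<open>i - 1 < k\<close> letters of \<open>W\<close> (lemma \<open>bullet_words_leading_word\<close>). So words with a \<open>W\<close>-prefix of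
  length \<open>k\<close> followed by a letter in the image of \<open>g\<close> are obtained by induction on \<open>k\<close>, inside an
  induction on the length of the word. Since \<open>V = W + g(V)\<close>, multilinearity reduces every word to
  such words and to words in \<open>T(W)\<close> (lemma \<open>words_in_if_bullet_closed\<close>).

  \<^emph>\<open>Com-Pre-Lie generation.\<close> By the first part it is enough to generate \<open>T(W)\<close>, and for this the
  shuffle product alone suffices: this is the generation half of Radford's theorem. A nonempty word
  that is not Lyndon is \<open>u @ v\<close> with \<open>v\<close> its least nonempty suffix and \<open>u\<close> nonempty. Every nonempty
  suffix of \<open>u\<close> is then at least \<open>v\<close>, which makes \<open>u @ v\<close> the largest word in the shuffle product of
  \<open>u\<close> and \<open>v\<close> (lemma \<open>shuffles_le_append\<close>). Its coefficient is a positive integer, hence invertible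
  in characteristic zero, so the word is a combination of a product of shorter words and of smaller
  words in the same letters (lemma \<open>words_in_if_lyndon_words_in\<close>).
\<close>

section \<open>Spans of words\<close>

lemma subspace_letters:
  assumes V: "vector_space scale"
    and S: "module.subspace fscale S" "tensor_rel scale \<subseteq> S"
  shows "module.subspace scale {y. word (p @ y # s) \<in> S}"
proof -
  interpret V: vector_space scale by (fact V)
  show ?thesis
  proof (rule V.subspaceI)
    have "word (p @ scale 0 0 # s) - fscale 0 (word (p @ 0 # s)) \<in> S"
      using rel_scale S(2) by blast
    then show "0 \<in> {y. word (p @ y # s) \<in> S}" by simp
  next
    fix x y assume "x \<in> {y. word (p @ y # s) \<in> S}" "y \<in> {y. word (p @ y # s) \<in> S}"
    moreover have "word (p @ (x + y) # s) - word (p @ x # s) - word (p @ y # s) \<in> S"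
      using rel_add S(2) by blast
    ultimately have "word (p @ (x + y) # s) - word (p @ x # s) - word (p @ y # s)
        + word (p @ x # s) + word (p @ y # s) \<in> S"
      by (intro free.subspace_add[OF S(1)]) auto
    then show "x + y \<in> {y. word (p @ y # s) \<in> S}" by simp
  next
    fix c x assume "x \<in> {y. word (p @ y # s) \<in> S}"
    moreover have "word (p @ scale c x # s) - fscale c (word (p @ x # s)) \<in> S"
      using rel_scale S(2) by blast
    ultimately have "word (p @ scale c x # s) - fscale c (word (p @ x # s))
        + fscale c (word (p @ x # s)) \<in> S"
      by (intro free.subspace_add[OF S(1)] free.subspace_scale[OF S(1)]) auto
    then show "scale c x \<in> {y. word (p @ y # s) \<in> S}" by simp
  qed
qed

text \<open>
  The letters are replaced by elements of \<open>X\<close> from left to right: \<open>p\<close> below is the part already in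
  \<open>X\<close>, \<open>s\<close> the rest. The length is recorded so that the lemma can be used inside an induction on the
  length of words.
\<close>

lemma word_in_if_letters_in_span:
  assumes V: "vector_space scale"
    and S: "module.subspace fscale S" "tensor_rel scale \<subseteq> S"
    and X: "\<And>t. t \<in> lists X \<Longrightarrow> length t = length u \<Longrightarrow> word t \<in> S"
    and u: "u \<in> lists (module.span scale X)"
  shows "word u \<in> S"
proof -
  interpret V: vector_space scale by (fact V)
  have "word (p @ s) \<in> S" if "s \<in> lists (V.span X)" "p \<in> lists X" "length (p @ s) = length u" for p s
    using that
  proof (induction s arbitrary: p rule: lists.induct)
    case Nil
    then show ?case using X by simp
  next
    case (Cons y s)
    have "word (p @ y # s) \<in> S" if "y \<in> X" for y
      using Cons.IH[of "p @ [y]"] Cons.prems that by simp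
    then show ?case
      using V.span_induct[OF \<open>y \<in> V.span X\<close> subspace_letters[OF V S]] by blast
  qed
  from this[of u "[]"] u show ?thesis by simp
qed

lemma poly_mapping_eq_sum_words:
  "p = (\<Sum>u\<in>Poly_Mapping.keys p. fscale (poly_mapping.lookup p u) (word u))"
  by (rule poly_mapping_eqI)
    (simp add: lookup_sum lookup_single when_def if_distrib[of "(*) _"] sum.delta' in_keys_iff cong: if_cong)

lemma tsubspace_preimage:
  assumes "tsubspace scale U"
  defines "S \<equiv> {p. tclass scale p \<in> U}"
  shows "module.subspace fscale S" and "tensor_rel scale \<subseteq> S"
proof -
  show "module.subspace fscale S"
  proof (rule free.subspaceI)
    show "0 \<in> S" using assms by (simp add: tsubspace_def)
    show "p + q \<in> S" if "p \<in> S" "q \<in> S" for p q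
      using that assms by (auto simp: tsubspace_def tadd_tclass[symmetric])
    show "fscale c p \<in> S" if "p \<in> S" for c p
      using that assms by (auto simp: tsubspace_def tscale_tclass[symmetric])
  qed
  have "tclass scale p = tclass scale 0" if "p \<in> tensor_rel scale" for p
    using that by (simp add: tclass_eq_iff)
  then show "tensor_rel scale \<subseteq> S"
    using assms by (auto simp: tsubspace_def)
qed

lemma bilin_ext_word [simp]: "bilin_ext f (word u) (word v) = f u v"
  by (simp add: bilin_ext_def)

lemma tensors_subset_if_words:
  assumes "tsubspace scale U" "\<And>u. tword scale u \<in> U"
  shows "tensors scale \<subseteq> U"
proof -
  have "p \<in> {p. tclass scale p \<in> U}" for p
    by (subst poly_mapping_eq_sum_words)
      (use assms(2) in \<open>auto simp: tword_def intro!: free.subspace_sum[OF tsubspace_preimage(1)[OF assms(1)]]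
        free.subspace_scale[OF tsubspace_preimage(1)[OF assms(1)], unfolded mem_Collect_eq] simp del: mem_Collect_eq\<close>)
  then show ?thesis by (auto simp: tensors_def)
qed

section \<open>The support of a shuffle product\<close>

lemma lookup_prepend:
  "poly_mapping.lookup (prepend x p) z =
    (case z of [] \<Rightarrow> 0 | y # z' \<Rightarrow> if y = x then poly_mapping.lookup p z' else 0)"
  by (cases z) (auto simp: prepend_def lin_ext_def lookup_sum lookup_single when_def in_keys_iff
      sum.delta' if_distrib[of "\<lambda>c. _ * c"] cong: if_cong)

lemma in_shuffles_if_lookup_nonzero:
  "poly_mapping.lookup (shuffle_words u v) z \<noteq> (0 :: 'k::field) \<Longrightarrow> z \<in> shuffles u v"
proof (induction u v arbitrary: z rule: shuffle_words.induct)
  case (3 x u y v)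
  then have "poly_mapping.lookup (prepend x (shuffle_words u (y # v))) z \<noteq> (0 :: 'k) \<or>
      poly_mapping.lookup (prepend y (shuffle_words (x # u) v)) z \<noteq> (0 :: 'k)"
    by (auto simp: lookup_add)
  then show ?case
    using "3.IH" by (auto simp: lookup_prepend split: if_splits list.splits)
qed (auto simp: lookup_single when_def split: if_splits)

text \<open>
  Coefficients of a shuffle product count interleavings, so no cancellation occurs in characteristic
  zero.
\<close>

lemma lookup_shuffle_words_is_nat:
  "\<exists>n. poly_mapping.lookup (shuffle_words u v) z = (of_nat n :: 'k::field)"
proof (induction u v arbitrary: z rule: shuffle_words.induct)
  case (1 v)
  show ?case by (auto simp: lookup_single when_def intro: exI[of _ 0] exI[of _ 1])
next
  case (2 x u)
  show ?case by (auto simp: lookup_single when_def intro: exI[of _ 0] exI[of _ 1])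
next
  case (3 x u y v)
  have "\<exists>n. poly_mapping.lookup (prepend x (shuffle_words u (y # v))) z = (of_nat n :: 'k)"
    "\<exists>n. poly_mapping.lookup (prepend y (shuffle_words (x # u) v)) z = (of_nat n :: 'k)"
    using 3 by (auto simp: lookup_prepend split: list.splits intro: exI[of _ 0])
  then show ?case by (auto simp: lookup_add simp flip: of_nat_add)
qed

lemma lookup_shuffle_words_append_nonzero:
  "poly_mapping.lookup (shuffle_words u v) (u @ v) \<noteq> (0 :: 'k::field_char_0)"
proof -
  have "\<exists>n. poly_mapping.lookup (shuffle_words u v) (u @ v) = (of_nat (Suc n) :: 'k)"
  proof (induction u v rule: shuffle_words.induct)
    case (3 x u y v)
    then obtain n where "poly_mapping.lookup (shuffle_words u (y # v)) (u @ y # v) = (of_nat (Suc n) :: 'k)"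
      by auto
    moreover obtain m where
      "poly_mapping.lookup (prepend y (shuffle_words (x # u) v)) (x # u @ y # v) = (of_nat m :: 'k)"
      using lookup_shuffle_words_is_nat[of "x # u" v "u @ y # v", where 'k='k]
      by (cases "x = y") (auto simp: lookup_prepend intro: that that[of 0])
    ultimately have "poly_mapping.lookup (shuffle_words (x # u) (y # v)) ((x # u) @ y # v)
        = (of_nat (Suc (n + m)) :: 'k)"
      by (simp add: lookup_add lookup_prepend[of x])
    then show ?case by blast
  qed (auto intro: exI[of _ 0])
  then show ?thesis by (auto simp del: of_nat_Suc)
qed

section \<open>The largest shuffle\<close>

text \<open>
  Moving a common prefix \<open>p\<close> from the larger of two words to the smaller one can only improve the
  largest shuffle. If \<open>z\<close> takes a letter of \<open>p\<close>, so does \<open>z'\<close>. If \<open>z\<close> takes the first letter \<open>c\<close> of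
  \<open>t\<close>, then \<open>z'\<close> takes the first letter of \<open>s\<close>: either this letter exceeds \<open>c\<close> and \<open>z'\<close> has won, or it is
  also \<open>c\<close>, and the same situation recurs with \<open>p @ [c]\<close> as the common prefix.
\<close>

lemma shuffles_exchange:
  fixes s t :: "'d::linorder list"
  assumes "t \<le> s" "z \<in> shuffles (p @ s) t"
  shows "\<exists>z'\<in>shuffles s (p @ t). z \<le> z'"
  using assms
proof (induction z arbitrary: p s t)
  case Nil
  then show ?case by auto
next
  case (Cons c z)
  show ?case
  proof (cases p)
    case Nil
    then show ?thesis using Cons.prems by auto
  next
    case p: (Cons a p')
    consider (left) "a = c" "z \<in> shuffles (p' @ s) t"
      | (right) t' where "t = c # t'" "z \<in> shuffles (p @ s) t'"
      using Cons.prems(2) p by (auto simp: Cons_in_shuffles_iff neq_Nil_conv)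
    then show ?thesis
    proof cases
      case left
      then obtain z' where "z' \<in> shuffles s (p' @ t)" "z \<le> z'"
        using Cons.IH Cons.prems(1) by blast
      then show ?thesis
        using left p by (intro bexI[of _ "c # z'"]) (auto intro: Cons_in_shuffles_rightI)
    next
      case right
      then obtain d s' where s: "s = d # s'" and d: "c < d \<or> c = d \<and> t' \<le> s'"
        using Cons.prems(1) by (cases s) auto
      from d show ?thesis
      proof
        assume "c < d"
        moreover obtain y where "y \<in> shuffles s' (p @ t)"
          using splice_in_shuffles by blast
        ultimately show ?thesis
          using s by (intro bexI[of _ "d # y"]) (auto intro: Cons_in_shuffles_leftI)
      next
        assume "c = d \<and> t' \<le> s'"
        then obtain z' where "z' \<in> shuffles s' ((p @ [c]) @ t')" "z \<le> z'"
          using Cons.IH[of t' s' "p @ [c]"] right s by auto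
        then show ?thesis
          using right s \<open>c = d \<and> t' \<le> s'\<close>
          by (intro bexI[of _ "c # z'"]) (auto intro: Cons_in_shuffles_leftI)
      qed
    qed
  qed
qed

text \<open>
  The critical case is a shuffle that begins with the first letter of \<open>v\<close> where this letter equals
  the first letter \<open>a\<close> of \<open>u\<close>. The exchange lemma trades this choice for \<open>a\<close> taken from \<open>u\<close> without
  losing anything, and the induction hypothesis for the rest of \<open>u\<close> applies.
\<close>

lemma shuffles_le_append:
  fixes u v :: "'d::linorder list"
  assumes "\<And>r s. u = r @ s \<Longrightarrow> s \<noteq> [] \<Longrightarrow> v \<le> s" "z \<in> shuffles u v"
  shows "z \<le> u @ v"
  using assms
proof (induction u arbitrary: z)
  case Nil
  then show ?case by simp
next
  case (Cons a u)
  have IH: "z \<le> u @ v" if "z \<in> shuffles u v" for z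
    by (rule Cons.IH[OF _ that]) (metis Cons.prems(1) append_Cons)
  have le: "v \<le> a # u" using Cons.prems(1)[of "[]"] by simp
  show ?case
  proof (cases v)
    case Nil
    then show ?thesis using Cons.prems(2) by simp
  next
    case v: (Cons b v')
    from Cons.prems(2) v consider (left) z' where "z = a # z'" "z' \<in> shuffles u v"
      | (right) z' where "z = b # z'" "z' \<in> shuffles ([a] @ u) v'"
      by auto
    then show ?thesis
    proof cases
      case left
      then show ?thesis using IH by simp
    next
      case right
      have "b < a \<or> b = a \<and> v' \<le> u" using le v by auto
      then show ?thesis
      proof
        assume "b < a"
        then show ?thesis using right by simp
      next
        assume *: "b = a \<and> v' \<le> u"
        then obtain z2 where "z2 \<in> shuffles u v" "z' \<le> z2"
          using shuffles_exchange[of v' u z' "[a]"] right v by auto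
        then show ?thesis using IH[of z2] right * by simp
      qed
    qed
  qed
qed

lemma between_append_obtains:
  fixes s t v :: "'d::linorder list"
  assumes "s \<le> v" "v \<le> s @ t"
  obtains v' where "v = s @ v'" "v' \<le> t"
proof -
  have "\<exists>v'. v = s @ v' \<and> v' \<le> t"
    using assms
  proof (induction s arbitrary: v)
    case (Cons a s)
    then show ?case by (cases v) auto
  qed simp
  with that show thesis by blast
qed

text \<open>
  Here \<open>v\<close> is the least nonempty suffix of \<open>w\<close>. If a nonempty suffix \<open>s\<close> of \<open>u\<close> were smaller than
  \<open>v\<close>, then \<open>s < v \<le> s @ v\<close> would make \<open>s\<close> a proper prefix of \<open>v\<close>, say \<open>v = s @ v'\<close> with \<open>v' \<le> v\<close>;
  minimality gives \<open>v' = v\<close>, which is absurd.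
\<close>

lemma not_lyndon_obtains_factorization:
  fixes w :: "'d::linorder list"
  assumes "w \<noteq> []" "\<not> lyndon w"
  obtains u v where "w = u @ v" "u \<noteq> []" "v \<noteq> []"
    "\<And>r s. u = r @ s \<Longrightarrow> s \<noteq> [] \<Longrightarrow> v \<le> s"
proof -
  let ?A = "{v. v \<noteq> [] \<and> (\<exists>u. w = u @ v)}"
  have "?A \<subseteq> set (suffixes w)" by (auto simp: suffix_def)
  then have fin: "finite ?A" by (rule finite_subset) simp
  have ne: "w \<in> ?A" using assms(1) by auto
  define v where "v = Min ?A"
  have "v \<in> ?A" unfolding v_def by (rule Min_in) (use fin ne in blast)+
  then obtain u where w: "w = u @ v" and v: "v \<noteq> []" by blast
  have least: "v \<le> v'" if "w = u' @ v'" "v' \<noteq> []" for u' v'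
    unfolding v_def by (rule Min_le) (use fin that in blast)+
  show thesis
  proof (rule that[OF w _ v])
    show "u \<noteq> []"
    proof
      assume "u = []"
      have "lyndon w"
        unfolding lyndon_def
      proof (intro conjI allI impI)
        fix x y assume xy: "w = x @ y" "x \<noteq> []" "y \<noteq> []"
        then have "w \<le> y" using least[of x y] w \<open>u = []\<close> by simp
        moreover have "w \<noteq> y" using xy by auto
        ultimately show "(w, y) \<in> lexord {(a, b). a < b}"
          by (simp add: list_le_def list_less_def)
      qed (fact assms(1))
      with assms(2) show False by simp
    qed
  next
    fix r s assume u: "u = r @ s" and s: "s \<noteq> []"
    show "v \<le> s"
    proof (rule ccontr)
      assume "\<not> v \<le> s"
      then have "s \<le> v" "s \<noteq> v" by auto
      moreover have "v \<le> s @ v" using least[of r "s @ v"] w u v by simp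
      ultimately obtain v' where v': "v = s @ v'" "v' \<le> v"
        using between_append_obtains by blast
      have "v \<le> v'" using least[of "u @ s" v'] w v' \<open>s \<noteq> v\<close> by auto
      with v' s show False by auto
    qed
  qed
qed

lemma lin_ext_sum: "finite A \<Longrightarrow> lin_ext f (sum a A) = (\<Sum>x\<in>A. lin_ext f (a x))"
  by (induction rule: finite_induct) (simp_all add: lin_ext_add)

lemma lin_ext_compose: "lin_ext f (lin_ext h p) = lin_ext (\<lambda>u. lin_ext f (h u)) p"
  by (simp add: lin_ext_def[of _ p] lin_ext_sum lin_ext_scale)

section \<open>Lyndon words generate the shuffle algebra\<close>

text \<open>
  The comparison of words takes place over the ordered index set of the basis; this map carries the
  result to words over \<open>V\<close>.
\<close>

definition relabel :: "('d \<Rightarrow> 'v) \<Rightarrow> ('d list \<Rightarrow>\<^sub>0 'k::field) \<Rightarrow> ('v list \<Rightarrow>\<^sub>0 'k)"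
  where "relabel w = lin_ext (\<lambda>u. word (map w u))"

lemma relabel_prepend: "relabel w (prepend x p) = prepend (w x) (relabel w p)"
proof -
  have "relabel w (prepend x p) = lin_ext (\<lambda>u. word (map w (x # u))) p"
    by (simp add: relabel_def prepend_def lin_ext_compose)
  also have "\<dots> = prepend (w x) (relabel w p)"
    by (simp add: relabel_def prepend_def lin_ext_compose)
  finally show ?thesis .
qed

lemma relabel_shuffle_words:
  "relabel w (shuffle_words u v) = shuffle_words (map w u) (map w v)"
  by (induction u v rule: shuffle_words.induct)
    (simp_all add: relabel_prepend lin_ext_add[of "\<lambda>u. word (map w u)", folded relabel_def],
     simp_all add: relabel_def)

text \<open>
  Words over \<open>D\<close> are handled by induction on their length and, for equal length, along the
  lexicographic order. This order is well-founded on the finitely many words of a given length over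
  a given finite set of letters, hence the number of smaller such words is used as a measure.
\<close>

lemma words_in_if_lyndon_words_in:
  fixes S :: "('v list \<Rightarrow>\<^sub>0 'k::field_char_0) set" and D :: "'d::linorder set"
  assumes S: "module.subspace fscale S"
    and shuffle: "\<And>p q. p \<in> S \<Longrightarrow> q \<in> S \<Longrightarrow> bilin_ext shuffle_words p q \<in> S"
    and Nil: "word [] \<in> S"
    and lyndon: "\<And>u. u \<in> lists D \<Longrightarrow> lyndon u \<Longrightarrow> word (map w u) \<in> S"
    and "x \<in> lists D"
  shows "word (map w x) \<in> S"
proof -
  define below where "below x = {y. y < x \<and> length y = length x \<and> set y \<subseteq> set x}" for x :: "'d list"
  have fin: "finite (below x)" for x
    by (rule finite_subset[OF _ finite_lists_length_eq[of "set x" "length x"]]) (auto simp: below_def)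
  show ?thesis
    using \<open>x \<in> lists D\<close>
  proof (induction x rule: wf_induct_rule[OF wf_measures[of "[length, \<lambda>x. card (below x)]"]])
    case (1 x)
    show ?case
    proof (cases "x = [] \<or> lyndon x")
      case True
      then show ?thesis using Nil lyndon 1(2) by auto
    next
      case False
      then obtain u v where x: "x = u @ v" "u \<noteq> []" "v \<noteq> []"
        and least: "\<And>r s. u = r @ s \<Longrightarrow> s \<noteq> [] \<Longrightarrow> v \<le> s"
        using not_lyndon_obtains_factorization by metis
      let ?c = "poly_mapping.lookup (shuffle_words u v :: 'd list \<Rightarrow>\<^sub>0 'k)"
      let ?K = "Poly_Mapping.keys (shuffle_words u v :: 'd list \<Rightarrow>\<^sub>0 'k)"
      have "word (map w u) \<in> S" "word (map w v) \<in> S"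
        using 1 x by auto
      then have "relabel w (shuffle_words u v) \<in> S"
        using shuffle[of "word (map w u)" "word (map w v)"] by (simp add: relabel_shuffle_words)
      also have "relabel w (shuffle_words u v) =
          fscale (?c x) (word (map w x)) + (\<Sum>z\<in>?K - {x}. fscale (?c z) (word (map w z)))"
        unfolding relabel_def lin_ext_def
        by (rule sum.remove) (use lookup_shuffle_words_append_nonzero[of u v, where 'k='k] x in \<open>auto simp: in_keys_iff\<close>)
      finally have total: "\<dots> \<in> S" .
      have "word (map w z) \<in> S" if "z \<in> ?K - {x}" for z
      proof -
        have z: "z \<in> shuffles u v" "z \<noteq> x"
          using that in_shuffles_if_lookup_nonzero[of u v z] by (auto simp: in_keys_iff)
        have "z \<le> u @ v"
          using least z(1) by (rule shuffles_le_append)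
        then have "z < x" using x z(2) by simp
        then have *: "z \<in> below x"
          using z x by (auto simp: below_def length_shuffles set_shuffles)
        then have "below z \<subset> below x"
          by (auto simp: below_def)
        then have "card (below z) < card (below x)"
          by (rule psubset_card_mono[OF fin])
        then show ?thesis
          by (intro 1(1)) (use 1(2) * in \<open>auto simp: below_def[of x]\<close>)
      qed
      then have "(\<Sum>z\<in>?K - {x}. fscale (?c z) (word (map w z))) \<in> S"
        by (intro free.subspace_sum[OF S] free.subspace_scale[OF S])
      from free.subspace_diff[OF S total this]
      have "fscale (?c x) (word (map w x)) \<in> S" by simp
      from free.subspace_scale[OF S this, of "inverse (?c x)"]
      show ?thesis using lookup_shuffle_words_append_nonzero[of u v, where 'k='k] x by simp
    qed
  qed
qed

section \<open>Generation by the pre-Lie product\<close>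

text \<open>
  The error terms come from the letters of \<open>p\<close> hit by \<open>g\<close>: the letter in position \<open>i\<close> is preceded by
  the first \<open>i - 1\<close> letters of \<open>p\<close> only, and all that follows is shuffled with \<open>s\<close>.
\<close>

lemma bullet_words_leading_word:
  fixes g :: "'v \<Rightarrow> 'v"
  assumes "p \<in> lists W"
  shows "bullet_words g (p @ [y]) s - (word (p @ g y # s) :: 'v list \<Rightarrow>\<^sub>0 'k::field) \<in> module.span fscale
    {word (q @ g x # r) | q x r. q \<in> lists W \<and> length q < length p \<and>
      length q + length r = length p + length s}" (is "_ \<in> module.span fscale (?B p)")
  using assms
proof (induction p rule: lists.induct)
  case Nil
  then show ?case by (simp add: prepend_def free.span_zero)
next
  case (Cons x p)
  have "prepend x t \<in> free.span (?B (x # p))" if "t \<in> free.span (?B p)" for t :: "'v list \<Rightarrow>\<^sub>0 'k"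
    using that
  proof (rule free.span_induct)
    show "free.subspace {t. prepend x t \<in> free.span (?B (x # p))}"
      by (rule free.subspaceI) (auto intro: free.span_zero free.span_add free.span_scale)
    fix t :: "'v list \<Rightarrow>\<^sub>0 'k" assume "t \<in> ?B p"
    then obtain q z r where "t = word (q @ g z # r)" "q \<in> lists W" "length q < length p"
      "length q + length r = length p + length s" by blast
    moreover from this have "word ((x # q) @ g z # r) \<in> ?B (x # p)"
      using \<open>x \<in> W\<close> by fastforce
    ultimately show "prepend x t \<in> free.span (?B (x # p))"
      by (auto simp: prepend_def intro: free.span_base)
  qed
  then have 1: "prepend x (bullet_words g (p @ [y]) s - word (p @ g y # s)) \<in> free.span (?B (x # p))"
    using Cons.IH by blast
  have "fscale (poly_mapping.lookup (shuffle_words (p @ [y]) s) r) (word (g x # r)) \<in> free.span (?B (x # p))" for r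
  proof (cases "poly_mapping.lookup (shuffle_words (p @ [y]) s) r = (0 :: 'k)")
    case False
    then have "length r = length p + 1 + length s"
      using in_shuffles_if_lookup_nonzero[OF False] by (simp add: length_shuffles)
    then have "word ([] @ g x # r) \<in> ?B (x # p)" by fastforce
    from free.span_base[OF this] show ?thesis by (intro free.span_scale) simp
  qed (simp add: free.span_zero)
  then have 2: "prepend (g x) (shuffle_words (p @ [y]) s) \<in> free.span (?B (x # p))"
    unfolding prepend_def lin_ext_def by (intro free.span_sum)
  show ?case
    using free.span_add[OF 1 2] by (simp add: prepend_def lin_ext_diff algebra_simps)
qed

text \<open>
  Induction on the length of the word. The leading term \<open>p @ g y # s\<close> of \<open>(p @ [y]) \<bullet> s\<close> is available
  as soon as \<open>p @ [y]\<close> is. That word is shorter unless \<open>s\<close> is empty; in that case it has full length,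
  and a second induction, on the power \<open>m\<close> in \<open>y = (g ^^ m) z\<close> with \<open>z \<in> W\<close>, produces it.
\<close>

lemma words_in_if_bullet_closed:
  fixes S :: "('v::ab_group_add list \<Rightarrow>\<^sub>0 'k::field) set"
  assumes V: "vector_space scale"
    and span: "module.span scale (\<Union>n. (g ^^ n) ` W) = UNIV"
    and S: "module.subspace fscale S" "tensor_rel scale \<subseteq> S"
    and bullet: "\<And>p q. p \<in> S \<Longrightarrow> q \<in> S \<Longrightarrow> bilin_ext (bullet_words g) p q \<in> S"
    and TW: "\<And>u. u \<in> lists W \<Longrightarrow> word u \<in> S"
  shows "word u \<in> S"
proof (induction u rule: length_induct)
  case (1 u)
  interpret V: vector_space scale by (fact V)
  let ?n = "length u"
  have shorter: "word t \<in> S" if "length t < ?n" for t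
    using 1 that by blast
  have lead: "word (p @ g y # s) \<in> S" if "p \<in> lists W" "length (p @ g y # s) = ?n"
    "word (p @ [y]) \<in> S" "word s \<in> S"
    "\<And>q x r. q \<in> lists W \<Longrightarrow> length q < length p \<Longrightarrow> length (q @ g x # r) = ?n \<Longrightarrow> word (q @ g x # r) \<in> S"
    for p y s
  proof -
    have "bullet_words g (p @ [y]) s \<in> S"
      using bullet[OF that(3,4)] by simp
    moreover have "bullet_words g (p @ [y]) s - word (p @ g y # s) \<in> S"
    proof (rule subsetD[OF free.span_minimal[OF _ S(1)] bullet_words_leading_word[OF that(1)]])
      show "{word (q @ g x # r) | q x r. q \<in> lists W \<and> length q < length p \<and>
          length q + length r = length p + length s} \<subseteq> S"
        using that(2) by (auto intro!: that(5))
    qed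
    ultimately have "bullet_words g (p @ [y]) s - (bullet_words g (p @ [y]) s - word (p @ g y # s)) \<in> S"
      by (rule free.subspace_diff[OF S(1)])
    then show ?thesis by simp
  qed
  have image_letter: "word (p @ g y # s) \<in> S" if "p \<in> lists W" "length (p @ g y # s) = ?n" for p y s
    using that
  proof (induction "length p" arbitrary: p y s rule: less_induct)
    case (less p y s)
    have prefix: "word (q @ g x # r) \<in> S"
      if "q \<in> lists W" "length q < length p" "length (q @ g x # r) = ?n" for q x r
      using less.hyps that by blast
    \<comment> \<open>A word with letters in \<open>W\<close>, except for an arbitrary last one: the case of empty \<open>s\<close>.\<close>
    have last: "word (p @ [y]) \<in> S" if "length p + 1 = ?n" for y
    proof -
      have "word (p @ [(g ^^ m) z]) \<in> S" if "z \<in> W" for m z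
      proof (induction m)
        case 0
        show ?case using TW[of "p @ [z]"] less.prems(1) \<open>z \<in> W\<close> by simp
      next
        case (Suc m)
        have "word (p @ g ((g ^^ m) z) # []) \<in> S"
          by (rule lead[OF less.prems(1) _ Suc TW prefix]) (use \<open>length p + 1 = ?n\<close> in auto)
        then show ?case by simp
      qed
      then have "word (p @ [y]) \<in> S" if "y \<in> (\<Union>n. (g ^^ n) ` W)" for y
        using that by blast
      moreover have "y \<in> V.span (\<Union>n. (g ^^ n) ` W)" using span by simp
      ultimately show ?thesis
        using V.span_induct[OF _ subspace_letters[OF V S, of p "[]"]] by blast
    qed
    have "word (p @ [y]) \<in> S"
    proof (cases s)
      case Nil
      then show ?thesis using last less.prems(2) by simp
    next
      case Cons
      then show ?thesis using shorter less.prems(2) by simp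
    qed
    moreover have "word s \<in> S"
      using shorter less.prems(2) by simp
    ultimately show ?case
      by (rule lead[OF less.prems _ _ prefix])
  qed
  have "V.span (W \<union> range g) = UNIV"
  proof -
    have "(\<Union>n. (g ^^ n) ` W) \<subseteq> W \<union> range g"
    proof
      fix y assume "y \<in> (\<Union>n. (g ^^ n) ` W)"
      then obtain n z where "y = (g ^^ n) z" "z \<in> W" by blast
      then show "y \<in> W \<union> range g" by (cases n) auto
    qed
    from V.span_mono[OF this] show ?thesis using span by (simp add: top.extremum_unique)
  qed
  then have u: "u \<in> lists (V.span (W \<union> range g))" by simp
  show ?case
  proof (rule word_in_if_letters_in_span[OF V S _ u])
    fix t assume t: "t \<in> lists (W \<union> range g)" "length t = ?n"
    show "word t \<in> S"
    proof (cases "t \<in> lists W")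
      case True
      then show ?thesis by (rule TW)
    next
      case False
      \<comment> \<open>The first letter outside \<open>W\<close> lies in the image of \<open>g\<close>.\<close>
      then obtain p x s where split: "t = p @ x # s" "x \<notin> W" "\<forall>y\<in>set p. y \<in> W"
        using split_list_first_prop[of t "\<lambda>x. x \<notin> W"] by auto
      then obtain y where "x = g y" using t(1) by auto
      then show ?thesis using image_letter[of p y s] split t(2) by auto
    qed
  qed
qed

section \<open>Generation of the tensor algebra\<close>

lemma pre_lie_subalgebra_eq_tensors:
  assumes V: "vector_space scale" and g: "Vector_Spaces.linear scale scale g"
    and span: "module.span scale (\<Union>n. (g ^^ n) ` W) = UNIV"
    and U: "pre_lie_subalgebra scale g U"
    and TW: "\<And>u. u \<in> lists W \<Longrightarrow> tword scale u \<in> U"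
  shows "U = tensors scale"
proof
  have sub: "tsubspace scale U" using U by (simp add: pre_lie_subalgebra_def)
  then show "U \<subseteq> tensors scale" by (simp add: tsubspace_def)
  let ?S = "{p. tclass scale p \<in> U}"
  have "bilin_ext (bullet_words g) p q \<in> ?S" if "p \<in> ?S" "q \<in> ?S" for p q
    using U that tbullet_tclass[OF g, of p q]
    by (metis mem_Collect_eq pre_lie_subalgebra_def)
  moreover have "word u \<in> ?S" if "u \<in> lists W" for u
    using TW[OF that] by (simp add: tword_def)
  ultimately have "word u \<in> ?S" for u
    by (rule words_in_if_bullet_closed[OF V span tsubspace_preimage[OF sub]])
  then show "tensors scale \<subseteq> U"
    by (intro tensors_subset_if_words[OF sub]) (simp add: tword_def)
qed

text \<open>
  The preimage of \<open>U\<close> contains all words in the basis letters, by shuffles alone; multilinearity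
  then gives \<open>T(W)\<close>, and the pre-Lie product gives the rest.
\<close>

lemma com_pre_lie_subalgebra_eq_tensors:
  fixes scale :: "'k::field_char_0 \<Rightarrow> 'v::ab_group_add \<Rightarrow> 'v" and D :: "'d::linorder set"
  assumes V: "vector_space scale" and g: "Vector_Spaces.linear scale scale g"
    and span: "module.span scale (\<Union>n. (g ^^ n) ` module.span scale (w ` D)) = UNIV"
    and U: "com_pre_lie_subalgebra scale g U"
    and Nil: "tword scale [] \<in> U"
    and lyndon: "\<And>u. u \<in> lists D \<Longrightarrow> lyndon u \<Longrightarrow> tword scale (map w u) \<in> U"
  shows "U = tensors scale"
proof (rule pre_lie_subalgebra_eq_tensors[OF V g span])
  show pre: "pre_lie_subalgebra scale g U"
    using U by (simp add: com_pre_lie_subalgebra_def)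
  fix u assume u: "u \<in> lists (module.span scale (w ` D))"
  let ?S = "{p. tclass scale p \<in> U}"
  have S: "module.subspace fscale ?S" "tensor_rel scale \<subseteq> ?S"
    using pre by (simp_all add: pre_lie_subalgebra_def tsubspace_preimage)
  have "bilin_ext shuffle_words p q \<in> ?S" if "p \<in> ?S" "q \<in> ?S" for p q
    using U that tshuffle_tclass[of scale p q]
    by (metis mem_Collect_eq com_pre_lie_subalgebra_def)
  then have "word (map w x) \<in> ?S" if "x \<in> lists D" for x
    by (rule words_in_if_lyndon_words_in[OF S(1) _ _ _ that])
      (use Nil lyndon in \<open>simp_all add: tword_def\<close>)
  then have "word t \<in> ?S" if "t \<in> lists (w ` D)" for t
    using that by (auto simp: lists_image)
  then have "word u \<in> ?S"
    by (rule word_in_if_letters_in_span[OF V S _ u])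
  then show "tword scale u \<in> U" by (simp add: tword_def)
qed

theorem corollary23:
  fixes scale :: "'k::field_char_0 \<Rightarrow> 'v::ab_group_add \<Rightarrow> 'v"
    and g :: "'v \<Rightarrow> 'v" and W :: "'v set"
  assumes "vector_space scale"
    and "Vector_Spaces.linear scale scale g"
    and "module.subspace scale W"
    and "module.span scale (\<Union>n. (g ^^ n) ` W) = UNIV"
  shows "(pre_lie_subalgebra scale g) hull (tensors_on scale W) = tensors scale \<and>
    (\<forall>(D :: 'd::linorder set) w.
      inj_on w D \<and> \<not> module.dependent scale (w ` D) \<and> module.span scale (w ` D) = W \<longrightarrow>
      (com_pre_lie_subalgebra scale g) hull
        ({tword scale []} \<union> {tword scale (map w u) | u. u \<in> lists D \<and> lyndon u})
      = tensors scale)"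
proof (intro conjI allI impI)
  have "tword scale u \<in> tensors_on scale W" if "u \<in> lists W" for u
    using that by (auto simp: tensors_on_def tword_def intro: free.span_base)
  then have "U = tensors scale" if "pre_lie_subalgebra scale g U" "tensors_on scale W \<subseteq> U" for U
    using pre_lie_subalgebra_eq_tensors[OF assms(1,2,4) that(1)] that(2) by blast
  moreover have "pre_lie_subalgebra scale g (tensors scale)"
    using com_pre_lie_subalgebra_tensors[OF assms(2)] by (simp add: com_pre_lie_subalgebra_def)
  moreover have "tensors_on scale W \<subseteq> tensors scale"
    by (auto simp: tensors_on_def tensors_def)
  ultimately show "(pre_lie_subalgebra scale g) hull (tensors_on scale W) = tensors scale"
    unfolding hull_def by blast
next
  fix D :: "'d set" and w
  assume w: "inj_on w D \<and> \<not> module.dependent scale (w ` D) \<and> module.span scale (w ` D) = W"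
  let ?G = "{tword scale []} \<union> {tword scale (map w u) | u. u \<in> lists D \<and> lyndon u}"
  have "U = tensors scale" if "com_pre_lie_subalgebra scale g U" "?G \<subseteq> U" for U
    by (rule com_pre_lie_subalgebra_eq_tensors[OF assms(1,2) _ that(1), of w D])
      (use w assms(4) that(2) in auto)
  moreover have "?G \<subseteq> tensors scale"
    by (auto simp: tword_def tensors_def)
  ultimately show "(com_pre_lie_subalgebra scale g) hull ?G = tensors scale"
    using com_pre_lie_subalgebra_tensors[OF assms(2)] unfolding hull_def by blast
qed

end
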